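(* Let $\ell\in\{0,2,4,\dots\}$ and let $u$ denote a real variable. Then $$\left[\frac{\partial^\ell}{\partial u^\ell}\mathrm{OU}(\zeta;q)\right]_{u=0}=\left[\frac{\partial^\ell}{\partial u^\ell}\left(q^{-\frac14}\,\mathrm{OU}_1(u;\tau)+H_1(\zeta;q)\right)\right]_{u=0}.$$
   Context: Conventions: $\tau$ lies in the upper half-plane, $q=e^{2\pi i\tau}$, $\zeta=e^{2\pi iu}$, and fractional powers are $q^{r}=e^{2\pi ir\tau}$; $(z;q)_\infty=\prod_{k\ge0}(1-zq^k)$ and $(z_1,z_2;q)_\infty=(z_1;q)_\infty(z_2;q)_\infty$. An odd unimodal sequence of size $n$ is a sequence of odd positive integers $a_1\le\dots\le a_r\le\bar c\ge b_1\ge\dots\ge b_s$ ($r,s\ge0$) with distinguished peak $\bar c$ and $n=\bar c+\sum a_j+\sum b_j$; its rank is $r-s$; $\mathrm{ou}(m,n)$ is the number of those of size $n$ and rank $m$, and $\mathrm{OU}(\zeta;q):=\sum_{n\ge0,\,m\in\mathbb Z}\mathrm{ou}(m,n)\zeta^mq^n$. $\eta(\tau)=q^{1/24}(q;q)_\infty$; $C(\zeta;q)=\frac{(q;q)_\infty}{(\zeta q,\zeta^{-1}q;q)_\infty}$; $C^*(u;\tau)=q^{-1/24}C(\zeta;q)$; $$\vartheta(u;\tau)=i\sum_{m\in\mathbb Z+\frac12}(-1)^{m-\frac12}q^{\frac{m^2}{2}}\zeta^m,\qquad \psi(u;\tau)=i\sum_{m\in\mathbb Z+\frac12}\mathrm{sgn}\left(m+\frac{\mathrm{Im}(u)}{\mathrm{Im}(\tau)}\right)(-1)^{m-\frac12}q^{\frac{m^2}{2}}\zeta^m.$$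 (In $C^*(u;2\tau)$, $\vartheta(2u;2\tau)$, $\psi(2u;2\tau)$ the variables $u,\tau$ are replaced accordingly, also in $\zeta$ and $q$.) Finally $$\mathrm{OU}_1(u;\tau):=-\frac i2\,\frac{C^*(u;\tau)}{\eta(\tau)}\,\frac{\eta(2\tau)}{C^*(u;2\tau)}\bigl(\vartheta(2u;2\tau)+\psi(2u;2\tau)\bigr),$$ $$H_1(\zeta;q):=\sum_{n\ge0}(-1)^{n+1}\zeta^{3n+1}q^{3n^2+2n}\left(1+\zeta q^{2n+1}\right).$$
   Formalization: The factor q^{-1/4} before OU_1 is corrected to q^{-1/3}: with the stated definitions OU_1 has leading power q^{1/3}, and the printed identity fails for ℓ=0 as Im τ→∞ (left side tends to 0, right side to -1). *)

theory Defs
  imports "HOL-Analysis.Analysis"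
begin

text \<open>
  All powers are taken through the exponential: if \<open>q = e2pi \<tau>\<close> and \<open>\<zeta> = e2pi u\<close>, then
  \<open>q\<^sup>r\<close> is \<open>e2pi (r * \<tau>)\<close> and \<open>\<zeta>\<^sup>m\<close> is \<open>e2pi (m * u)\<close>, also for fractional \<open>r\<close> and \<open>m\<close>.
\<close>

definition e2pi :: "complex \<Rightarrow> complex" where
  "e2pi z = exp (2 * of_real pi * \<i> * z)"

definition qpoch_inf :: "complex \<Rightarrow> complex \<Rightarrow> complex" where
  "qpoch_inf z q = (\<Prod>k. 1 - z * q ^ k)"

text \<open>
  The triple \<open>(as, c, bs)\<close> stands for the sequence \<open>as @ [c] @ bs\<close> with distinguished peak \<open>c\<close>;
  either list may be empty and entries equal to \<open>c\<close> are allowed in both. Positivity of the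
  entries follows from oddness.
\<close>

definition odd_unimodal :: "nat list \<times> nat \<times> nat list \<Rightarrow> bool" where
  "odd_unimodal = (\<lambda>(as, c, bs).
     (\<forall>x \<in> set (as @ [c] @ bs). odd x) \<and>
     sorted_wrt (\<le>) (as @ [c]) \<and> sorted_wrt (\<ge>) ([c] @ bs))"

definition unimodal_size :: "nat list \<times> nat \<times> nat list \<Rightarrow> nat" where
  "unimodal_size = (\<lambda>(as, c, bs). c + sum_list as + sum_list bs)"

definition unimodal_rank :: "nat list \<times> nat \<times> nat list \<Rightarrow> int" where
  "unimodal_rank = (\<lambda>(as, c, bs). int (length as) - int (length bs))"

definition ou :: "int \<Rightarrow> nat \<Rightarrow> nat" where
  "ou m n = card {s. odd_unimodal s \<and> unimodal_size s = n \<and> unimodal_rank s = m}"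

definition OU :: "complex \<Rightarrow> complex \<Rightarrow> complex" where
  "OU \<zeta> q = (\<Sum>\<^sub>\<infinity>(n, m) \<in> (UNIV :: (nat \<times> int) set). of_nat (ou m n) * \<zeta> powi m * q ^ n)"

definition dedekind_eta :: "complex \<Rightarrow> complex" where
  "dedekind_eta \<tau> = e2pi (\<tau> / 24) * qpoch_inf (e2pi \<tau>) (e2pi \<tau>)"

definition crank_gf :: "complex \<Rightarrow> complex \<Rightarrow> complex" where
  "crank_gf \<zeta> q = qpoch_inf q q / (qpoch_inf (\<zeta> * q) q * qpoch_inf (inverse \<zeta> * q) q)"

definition Cstar :: "complex \<Rightarrow> complex \<Rightarrow> complex" where
  "Cstar u \<tau> = e2pi (- \<tau> / 24) * crank_gf (e2pi u) (e2pi \<tau>)"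

text \<open>
  In both sums the half-integer \<open>m\<close> is written as \<open>k + 1/2\<close> with an integer \<open>k\<close>, so that
  \<open>m - 1/2 = k\<close>.
\<close>

definition jacobi_theta :: "complex \<Rightarrow> complex \<Rightarrow> complex" where
  "jacobi_theta u \<tau> = \<i> * (\<Sum>\<^sub>\<infinity>k \<in> (UNIV :: int set).
     let m = of_int k + 1/2 :: real in
     (-1) powi k * e2pi (of_real (m\<^sup>2 / 2) * \<tau>) * e2pi (of_real m * u))"

definition false_theta :: "complex \<Rightarrow> complex \<Rightarrow> complex" where
  "false_theta u \<tau> = \<i> * (\<Sum>\<^sub>\<infinity>k \<in> (UNIV :: int set).
     let m = of_int k + 1/2 :: real in
     of_real (sgn (m + Im u / Im \<tau>)) *
       (-1) powi k * e2pi (of_real (m\<^sup>2 / 2) * \<tau>) * e2pi (of_real m * u))"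

text \<open>
  The prefactors \<open>q\<^sup>r\<close> of \<open>Cstar\<close> and \<open>dedekind_eta\<close> do not cancel in the following product:
  together they give \<open>q\<^bsup>-1/24 - 1/24 + 2/24 + 2/24\<^esup> = q\<^bsup>1/12\<^esup>\<close>. The theta functions contribute a
  further \<open>q\<^bsup>1/4\<^esup>\<close>, so that \<open>q\<^bsup>-1/3\<^esup> * OU1\<close> is the power series in \<open>q\<close> that occurs in the
  decomposition of \<open>OU\<close>.
\<close>

definition OU1 :: "complex \<Rightarrow> complex \<Rightarrow> complex" where
  "OU1 u \<tau> = - (\<i> / 2) * (Cstar u \<tau> / dedekind_eta \<tau>) * (dedekind_eta (2 * \<tau>) / Cstar u (2 * \<tau>)) *
     (jacobi_theta (2 * u) (2 * \<tau>) + false_theta (2 * u) (2 * \<tau>))"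

definition H1 :: "complex \<Rightarrow> complex \<Rightarrow> complex" where
  "H1 \<zeta> q = (\<Sum>n. (-1) ^ (n + 1) * \<zeta> ^ (3 * n + 1) * q ^ (3 * n\<^sup>2 + 2 * n) * (1 + \<zeta> * q ^ (2 * n + 1)))"

definition real_deriv_iter :: "nat \<Rightarrow> (real \<Rightarrow> complex) \<Rightarrow> real \<Rightarrow> complex" where
  "real_deriv_iter l f = ((\<lambda>g u. vector_derivative g (at u)) ^^ l) f"

end

theory Submission
  imports Defs
begin

text \<open>
  For real \<open>u\<close> both sides are the same function of \<open>u\<close>, so nothing has to be differentiated. Sorting
  the sequences by their peak \<open>2n + 1\<close> gives \<open>OU = F\<close> with
  \<open>F(z) = \<Sum>n. q\<^bsup>2n+1\<^esup> / ((zq, q/z; q\<^sup>2)\<^bsub>n+1\<^esub>)\<close>, and since \<open>u\<close> is real, the terms with negative index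
  cancel in \<open>\<vartheta> + \<psi>\<close>, so that \<open>q\<^bsup>-1/3\<^esup> OU1 = S(z) / (zq, q/z; q\<^sup>2)\<^bsub>\<infinity>\<^esub>\<close> with the partial theta function
  \<open>S(z) = \<Sum>n. (-1)\<^sup>n z\<^bsup>2n+1\<^esup> q\<^bsup>n(n+1)\<^esup>\<close>. The difference \<open>E\<close> of the two sides satisfies
  \<open>E(z) = - z\<^sup>3 q\<^sup>3 E(z q\<^sup>2)\<close>: the inhomogeneous part for \<open>F\<close> is a telescoping sum. As \<open>E\<close> is bounded on
  the circles \<open>|z| = |q|\<^bsup>2N\<^esup>\<close>, which stay away from the poles, iteration gives \<open>E = 0\<close>.
\<close>

section \<open>The generating function of odd unimodal sequences\<close>

text \<open>Fubini for a product of two absolutely summable families. Absolute summability is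
  returned together with the value, so that the rule can be applied again to its own result.\<close>

lemma has_sum_mult_Times:
  fixes f :: "'b \<Rightarrow> 'a::{real_normed_field,banach}"
  assumes f: "(f has_sum a) A" "(\<lambda>x. norm (f x)) summable_on A"
    and g: "(g has_sum b) B" "(\<lambda>x. norm (g x)) summable_on B"
  shows "((\<lambda>(x, y). f x * g y) has_sum (a * b)) (A \<times> B)"
    and "(\<lambda>p. norm (case p of (x, y) \<Rightarrow> f x * g y)) summable_on (A \<times> B)"
proof -
  show *: "(\<lambda>p. norm (case p of (x, y) \<Rightarrow> f x * g y)) summable_on (A \<times> B)"
    using f(2) g(2)
    by (intro iffD2[OF Infinite_Sum.abs_summable_on_Sigma_iff])
      (auto simp: norm_mult infsum_cmult_right' abs_mult
        intro!: summable_on_cmult_right summable_on_cmult_left)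
  show "((\<lambda>(x, y). f x * g y) has_sum (a * b)) (A \<times> B)"
  proof (rule has_sum_SigmaI)
    show "((\<lambda>y. case (x, y) of (x, y) \<Rightarrow> f x * g y) has_sum f x * b) B" for x
      using has_sum_cmult_right[OF g(1)] by simp
    show "((\<lambda>x. f x * b) has_sum a * b) A"
      by (rule has_sum_cmult_left[OF f(1)])
    show "(\<lambda>(x, y). f x * g y) summable_on A \<times> B"
      by (rule abs_summable_summable[OF *])
  qed
qed

lemma has_sum_geometric:
  fixes x :: "'a::{real_normed_field,banach}"
  assumes "norm x < 1"
  shows "((\<lambda>j. x ^ j) has_sum (1 / (1 - x))) UNIV" "(\<lambda>j. norm (x ^ j)) summable_on UNIV"
proof -
  have s: "summable (\<lambda>j. norm (x ^ j))"
    using assms by (simp add: norm_power summable_geometric)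
  show "((\<lambda>j. x ^ j) has_sum (1 / (1 - x))) UNIV"
    by (rule norm_summable_imp_has_sum[OF s geometric_sums[OF assms]])
  show "(\<lambda>j. norm (x ^ j)) summable_on UNIV"
    using s by (intro norm_summable_imp_summable_on) simp
qed

section \<open>Partitions into odd parts\<close>

text \<open>Partitions with part sizes 1, 3, ..., 2n - 1. The bound \<open>2 * n\<close> makes n the
  number of available sizes, so an induction on n adds one size at a time.\<close>

definition odd_lists :: "nat \<Rightarrow> nat list set" where
  "odd_lists n = {xs. sorted xs \<and> (\<forall>x\<in>set xs. odd x \<and> x < 2 * n)}"

lemma odd_lists_0: "odd_lists 0 = {[]}"
  by (auto simp: odd_lists_def)

text \<open>In a sorted list the copies of the largest available part 2n + 1 form a final block; its
  length j is free.\<close>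

lemma odd_lists_Suc_bij:
  "bij_betw (\<lambda>(xs, j). xs @ replicate j (2 * n + 1)) (odd_lists n \<times> UNIV) (odd_lists (Suc n))"
proof (rule bij_betwI')
  fix p p' :: "nat list \<times> nat"
  assume p: "p \<in> odd_lists n \<times> UNIV" "p' \<in> odd_lists n \<times> UNIV"
  obtain xs j where pe: "p = (xs, j)" by fastforce
  obtain ys k where pe': "p' = (ys, k)" by fastforce
  \<comment> \<open>Filtering by \<open>x < 2 * n\<close> deletes the final block and nothing else,
    which recovers the first component.\<close>
  have f: "filter (\<lambda>x. x < 2 * n) xs = xs" "filter (\<lambda>x. x < 2 * n) ys = ys"
    using p by (auto simp: pe pe' odd_lists_def filter_id_conv)
  show "((case p of (xs, j) \<Rightarrow> xs @ replicate j (2 * n + 1)) =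
      (case p' of (xs, j) \<Rightarrow> xs @ replicate j (2 * n + 1))) = (p = p')"
  proof
    assume eq: "(case p of (xs, j) \<Rightarrow> xs @ replicate j (2 * n + 1)) =
      (case p' of (xs, j) \<Rightarrow> xs @ replicate j (2 * n + 1))"
    then have eq: "xs @ replicate j (2 * n + 1) = ys @ replicate k (2 * n + 1)"
      by (simp add: pe pe')
    from arg_cong[OF this, of "filter (\<lambda>x. x < 2 * n)"] have "xs = ys"
      using f by simp
    with eq show "p = p'" by (simp add: pe pe')
  qed auto
next
  fix p :: "nat list \<times> nat"
  assume "p \<in> odd_lists n \<times> UNIV"
  then show "(case p of (xs, j) \<Rightarrow> xs @ replicate j (2 * n + 1)) \<in> odd_lists (Suc n)"
    by (fastforce simp: odd_lists_def sorted_append)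
next
  fix zs assume zs: "zs \<in> odd_lists (Suc n)"
  have "sorted zs \<Longrightarrow> \<forall>x\<in>set zs. odd x \<and> x < 2 * Suc n \<Longrightarrow>
    \<exists>xs j. zs = xs @ replicate j (2 * n + 1) \<and> xs \<in> odd_lists n"
  proof (induction zs rule: rev_induct)
    case Nil
    then show ?case by (auto simp: odd_lists_def)
  next
    case (snoc z zs)
    show ?case
    proof (cases "z = 2 * n + 1")
      case True
      from snoc obtain xs j where "zs = xs @ replicate j (2 * n + 1)" "xs \<in> odd_lists n"
        by (auto simp: sorted_append)
      then show ?thesis
        using True by (intro exI[of _ xs] exI[of _ "Suc j"]) (simp add: replicate_append_same)
    next
      case False
      with snoc.prems(2) have "odd z" "z < 2 * Suc n" by auto
      with False have "z < 2 * n" by presburger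
      then have "zs @ [z] \<in> odd_lists n"
        using snoc.prems by (fastforce simp: odd_lists_def sorted_append)
      then show ?thesis
        by (intro exI[of _ "zs @ [z]"] exI[of _ 0]) simp
    qed
  qed
  then show "\<exists>p\<in>odd_lists n \<times> UNIV. zs = (case p of (xs, j) \<Rightarrow> xs @ replicate j (2 * n + 1))"
    using zs unfolding odd_lists_def[of "Suc n"] by fastforce
qed

text \<open>Each new part size contributes a geometric series in its multiplicity. The statement
  covers real and complex fields because it is used for the weights and for their norms.\<close>

lemma has_sum_odd_lists:
  fixes x q :: "'a::{real_normed_field,banach}"
  assumes x: "norm x \<le> 1" and q: "norm q < 1"
  shows "((\<lambda>xs. x ^ length xs * q ^ sum_list xs) has_sum (\<Prod>k<n. 1 / (1 - x * q ^ (2 * k + 1)))) (odd_lists n)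
       \<and> (\<lambda>xs. norm (x ^ length xs * q ^ sum_list xs)) summable_on (odd_lists n)"
proof (induction n)
  case 0
  then show ?case by (auto simp: odd_lists_0 intro!: has_sum_finiteI)
next
  case (Suc n)
  let ?f = "\<lambda>xs. x ^ length xs * q ^ sum_list xs"
  let ?y = "x * q ^ (2 * n + 1)"
  let ?b = "\<lambda>(xs, j). xs @ replicate j (2 * n + 1)"
  have "norm q ^ (2 * n + 1) < 1"
    using q by (simp add: power_less_one_iff del: power_Suc)
  then have y: "norm ?y < 1"
    using x mult_left_le_one_le[of "norm q ^ (2 * n + 1)" "norm x"]
    by (simp add: norm_mult norm_power del: power_Suc)
  note geo = has_sum_geometric[OF y]
  note prod = has_sum_mult_Times[OF conjunct1[OF Suc] conjunct2[OF Suc] geo]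
  have rep: "?f (xs @ replicate j m) = ?f xs * (x * q ^ m) ^ j" for xs j m
    by (simp add: power_add power_mult_distrib sum_list_replicate mult.commute[of j m] power_mult)
  have eq: "(\<lambda>p. ?f (?b p)) = (\<lambda>(xs, j). ?f xs * ?y ^ j)"
    using rep by (auto simp: fun_eq_iff simp del: power_Suc)
  have "((\<lambda>p. ?f (?b p)) has_sum (\<Prod>k<Suc n. 1 / (1 - x * q ^ (2 * k + 1)))) (odd_lists n \<times> UNIV)"
    unfolding eq using prod(1) by (simp add: mult.assoc)
  moreover have "(\<lambda>p. norm (?f (?b p))) summable_on (odd_lists n \<times> UNIV)"
    using prod(2) by (simp only: fun_cong[OF eq])
  ultimately show ?case
    using has_sum_reindex_bij_betw[OF odd_lists_Suc_bij[of n], of ?f]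
      summable_on_reindex_bij_betw[OF odd_lists_Suc_bij[of n], of "\<lambda>xs. norm (?f xs)"]
    by blast
qed

text \<open>The product \<open>(zq, q/z; q^2)_n\<close>. Its reciprocal counts pairs of partitions
  into odd parts below 2n, with z recording the difference of the numbers of parts.\<close>

definition odd_poch :: "complex \<Rightarrow> complex \<Rightarrow> nat \<Rightarrow> complex" where
  "odd_poch q z n = (\<Prod>k<n. (1 - z * q ^ (2 * k + 1)) * (1 - q ^ (2 * k + 1) / z))"

lemma odd_poch_0 [simp]: "odd_poch q z 0 = 1"
  and odd_poch_Suc: "odd_poch q z (Suc n) =
    odd_poch q z n * ((1 - z * q ^ (2 * n + 1)) * (1 - q ^ (2 * n + 1) / z))"
  by (simp_all add: odd_poch_def)

text \<open>The full infinite product serves as c: it is nonzero because the powers are summable,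
  and dropping factors from ]0, 1] only increases a product. Arbitrary finite index sets are allowed
  since the later products run over reflected and shifted ranges.\<close>

lemma odd_prod_bounded_below:
  fixes r :: real
  assumes r: "0 \<le> r" "r < 1"
  obtains c where "0 < c" "\<And>A. finite A \<Longrightarrow> c \<le> (\<Prod>k\<in>A. 1 - r ^ (2 * k + 1))"
proof -
  let ?f = "\<lambda>k. 1 - r ^ (2 * k + 1)"
  have f: "0 < ?f k" "?f k \<le> 1" for k
    using r by (auto simp: power_less_one_iff simp del: power_Suc)
  have "summable (\<lambda>k. r * (r\<^sup>2) ^ k)"
    using r by (intro summable_mult summable_geometric) (simp add: power_less_one_iff)
  then have "convergent_prod ?f"
    using r
    by (intro abs_convergent_prod_imp_convergent_prod summable_imp_abs_convergent_prod)
       (simp add: power_mult)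
  then have lim: "(\<lambda>n. \<Prod>i\<le>n. ?f i) \<longlonglongrightarrow> prodinf ?f" and "prodinf ?f \<noteq> 0"
    by (simp_all only: convergent_prod_LIMSEQ prodinf_nonzero less_imp_neq[OF f(1), symmetric] not_False_eq_True)
  have dec: "(\<Prod>i\<in>B. ?f i) \<le> (\<Prod>i\<in>A. ?f i)" if "A \<subseteq> B" "finite B" for A B
  proof -
    have "(\<Prod>i\<in>B. ?f i) = (\<Prod>i\<in>A. ?f i) * (\<Prod>i\<in>B - A. ?f i)"
      using that prod.subset_diff[of A B ?f] by (simp add: mult.commute)
    also have "\<dots> \<le> (\<Prod>i\<in>A. ?f i) * 1"
      using f by (intro mult_left_mono prod_le_1 prod_nonneg) (auto simp: less_imp_le simp del: power_Suc)
    finally show ?thesis by simp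
  qed
  have le: "prodinf ?f \<le> (\<Prod>k\<in>A. ?f k)" if A: "finite A" for A
  proof (rule LIMSEQ_le_const2[OF lim])
    obtain m where "A \<subseteq> {..m}"
      using A finite_nat_iff_bounded_le by blast
    then show "\<exists>N. \<forall>n\<ge>N. (\<Prod>i\<le>n. ?f i) \<le> (\<Prod>k\<in>A. ?f k)"
      by (intro exI[of _ m] allI impI dec) auto
  qed
  have "0 \<le> prodinf ?f"
    using f by (intro LIMSEQ_le_const[OF lim]) (auto intro!: prod_nonneg simp: less_imp_le simp del: power_Suc)
  with \<open>prodinf ?f \<noteq> 0\<close> le that show ?thesis by (simp add: less_le)
qed

text \<open>Once the peak 2n + 1 is fixed, the two flanks are independent partitions into odd parts
  at most 2n + 1, so the weight factorises.\<close>

lemma has_sum_odd_unimodal: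
  fixes q z :: complex
  assumes q: "norm q < 1" and z: "norm z = 1"
  defines "f \<equiv> \<lambda>s. z powi unimodal_rank s * q ^ unimodal_size s"
  shows "(\<lambda>x. norm (f x)) summable_on Collect odd_unimodal"
    and "(f has_sum (\<Sum>n. q ^ (2 * n + 1) / odd_poch q z (Suc n))) (Collect odd_unimodal)"
proof -
  let ?r = "norm q"
  obtain c where c: "0 < c" "\<And>A. finite A \<Longrightarrow> c \<le> (\<Prod>k\<in>A. 1 - ?r ^ (2 * k + 1))"
    using odd_prod_bounded_below[of ?r] q by auto
  \<comment> \<open>The right flank is decreasing and is therefore the reversal of a list in
    \<open>odd_lists\<close>.\<close>
  let ?b = "\<lambda>(n, as, bs). (as, 2 * n + 1, rev bs)"
  let ?S = "SIGMA n:UNIV. odd_lists (Suc n) \<times> odd_lists (Suc n)"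
  have bij: "bij_betw ?b ?S (Collect odd_unimodal)"
  proof (rule bij_betw_byWitness[where f' = "\<lambda>(as, c, bs). (c div 2, as, rev bs)"])
    have *: "2 * (c div 2) + 1 = c" "x \<le> c \<longleftrightarrow> x < 2 * Suc (c div 2)" if "odd c" for x c :: nat
      using that by presburger+
    show "?b ` ?S \<subseteq> Collect odd_unimodal"
      by (fastforce simp: odd_unimodal_def odd_lists_def sorted_wrt_append sorted_wrt_rev)
    show "(\<lambda>(as, c, bs). (c div 2, as, rev bs)) ` Collect odd_unimodal \<subseteq> ?S"
      using *(2) by (fastforce simp: odd_unimodal_def odd_lists_def sorted_wrt_append sorted_wrt_rev)
    show "\<forall>s\<in>Collect odd_unimodal. ?b ((\<lambda>(as, c, bs). (c div 2, as, rev bs)) s) = s"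
      using *(1) by (auto simp: odd_unimodal_def)
  qed auto
  have [simp]: "z \<noteq> 0" using z by auto
  let ?g = "\<lambda>z xs. z ^ length xs * q ^ sum_list xs"
  let ?P = "\<lambda>z n. \<Prod>k<n. 1 / (1 - z * q ^ (2 * k + 1))"
  have fb: "f (as, 2 * n + 1, rev bs) = q ^ (2 * n + 1) * (?g z as * ?g (inverse z) bs)" for n as bs
    by (simp add: f_def unimodal_rank_def unimodal_size_def power_int_diff power_add
        power_inverse field_simps sum_list_rev)
  have inv: "norm (inverse z) \<le> 1" using z by (simp add: norm_inverse)
  note L1 = has_sum_odd_lists[of z q] has_sum_odd_lists[of "inverse z" q]
  note L = has_sum_mult_Times[OF conjunct1 conjunct2 conjunct1 conjunct2, OF L1(1) L1(1) L1(2) L1(2)]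
  have in_sum: "((\<lambda>p. f (?b (n, p))) has_sum (q ^ (2 * n + 1) / odd_poch q z (Suc n)))
    (odd_lists (Suc n) \<times> odd_lists (Suc n))" for n
  proof -
    have "((\<lambda>p. q ^ (2 * n + 1) * (case p of (as, bs) \<Rightarrow> ?g z as * ?g (inverse z) bs)) has_sum
      (q ^ (2 * n + 1) * (?P z (Suc n) * ?P (inverse z) (Suc n))))
      (odd_lists (Suc n) \<times> odd_lists (Suc n))"
      using q z inv by (intro has_sum_cmult_right L) auto
    moreover have "?P z (Suc n) * ?P (inverse z) (Suc n) = 1 / odd_poch q z (Suc n)"
      unfolding odd_poch_def prod.distrib prod_dividef
      by (simp add: divide_inverse mult.commute del: prod.lessThan_Suc power_Suc)
    ultimately have "((\<lambda>p. q ^ (2 * n + 1) * (case p of (as, bs) \<Rightarrow> ?g z as * ?g (inverse z) bs)) has_sum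
      (q ^ (2 * n + 1) * (1 / odd_poch q z (Suc n)))) (odd_lists (Suc n) \<times> odd_lists (Suc n))"
      by (simp only:)
    moreover have "f (?b (n, p)) = q ^ (2 * n + 1) * (case p of (as, bs) \<Rightarrow> ?g z as * ?g (inverse z) bs)" for p
      by (cases p) (simp only: prod.case fb)
    ultimately show ?thesis
      by (simp only: mult_1_right times_divide_eq_right)
  qed
  \<comment> \<open>As |z| = 1, the norms form the same generating function at z = 1 with q replaced
    by |q|.\<close>
  have nsum: "((\<lambda>p. norm (f (?b (n, p)))) has_sum
     (?r ^ (2 * n + 1) * ((\<Prod>k<Suc n. 1 / (1 - ?r ^ (2 * k + 1))) * (\<Prod>k<Suc n. 1 / (1 - ?r ^ (2 * k + 1))))))
    (odd_lists (Suc n) \<times> odd_lists (Suc n))" for n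
  proof -
    let ?h = "\<lambda>xs. 1 ^ length xs * ?r ^ sum_list xs"
    have "((\<lambda>p. ?r ^ (2 * n + 1) * (case p of (as, bs) \<Rightarrow> ?h as * ?h bs)) has_sum
      (?r ^ (2 * n + 1) * ((\<Prod>k<Suc n. 1 / (1 - 1 * ?r ^ (2 * k + 1))) * (\<Prod>k<Suc n. 1 / (1 - 1 * ?r ^ (2 * k + 1))))))
      (odd_lists (Suc n) \<times> odd_lists (Suc n))"
      using q has_sum_odd_lists[of "1::real" ?r "Suc n"]
      by (intro has_sum_cmult_right has_sum_mult_Times) auto
    moreover have "norm (f (?b (n, p))) = ?r ^ (2 * n + 1) * (case p of (as, bs) \<Rightarrow> ?h as * ?h bs)" for p
      by (cases p) (simp only: prod.case fb norm_mult norm_power norm_inverse z inverse_1)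
    ultimately show ?thesis by (simp only: mult_1)
  qed
  have abs: "(\<lambda>p. norm (f (?b p))) summable_on ?S"
  proof (rule summable_on_SigmaI[OF nsum])
    \<comment> \<open>Each of the two partition products is at most 1/c, independently of n, which
      leaves a geometric series in |q|^2.\<close>
    have sm: "(\<lambda>n. ?r ^ (2 * n + 1) * (1 / c * (1 / c))) summable_on UNIV"
    proof (rule summable_nonneg_imp_summable_on)
      have "summable (\<lambda>n. ?r * (?r\<^sup>2) ^ n * (1 / c * (1 / c)))"
        using q by (intro summable_mult summable_mult2 summable_geometric)
          (simp add: power_less_one_iff)
      then show "summable (\<lambda>n. ?r ^ (2 * n + 1) * (1 / c * (1 / c)))"
        by (simp add: power_mult)
    qed (use c in simp)
    have P: "0 \<le> (\<Prod>k<Suc n. 1 / (1 - ?r ^ (2 * k + 1)))"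
      "(\<Prod>k<Suc n. 1 / (1 - ?r ^ (2 * k + 1))) \<le> 1 / c" for n
    proof -
      have "c \<le> (\<Prod>k<Suc n. 1 - ?r ^ (2 * k + 1))" by (rule c) simp
      moreover have "(\<Prod>k<Suc n. 1 / (1 - ?r ^ (2 * k + 1))) = 1 / (\<Prod>k<Suc n. 1 - ?r ^ (2 * k + 1))"
        by (simp only: prod_dividef prod.neutral_const)
      ultimately show "0 \<le> (\<Prod>k<Suc n. 1 / (1 - ?r ^ (2 * k + 1)))"
        "(\<Prod>k<Suc n. 1 / (1 - ?r ^ (2 * k + 1))) \<le> 1 / c"
        using c(1) by (auto intro!: frac_le simp del: power_Suc prod.lessThan_Suc)
    qed
    show "(\<lambda>n. ?r ^ (2 * n + 1) * ((\<Prod>k<Suc n. 1 / (1 - ?r ^ (2 * k + 1))) *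
      (\<Prod>k<Suc n. 1 / (1 - ?r ^ (2 * k + 1))))) summable_on UNIV"
      using sm
    proof (rule summable_on_comparison_test)
      show "?r ^ (2 * n + 1) * ((\<Prod>k<Suc n. 1 / (1 - ?r ^ (2 * k + 1))) *
        (\<Prod>k<Suc n. 1 / (1 - ?r ^ (2 * k + 1)))) \<le> ?r ^ (2 * n + 1) * (1 / c * (1 / c))" for n
        using c(1) by (intro mult_left_mono mult_mono P zero_le_power norm_ge_zero) simp
      show "0 \<le> ?r ^ (2 * n + 1) * ((\<Prod>k<Suc n. 1 / (1 - ?r ^ (2 * k + 1))) *
        (\<Prod>k<Suc n. 1 / (1 - ?r ^ (2 * k + 1))))" for n
        by (intro mult_nonneg_nonneg P zero_le_power norm_ge_zero)
    qed
  qed auto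
  show "(\<lambda>x. norm (f x)) summable_on Collect odd_unimodal"
    using abs summable_on_reindex_bij_betw[OF bij, of "\<lambda>s. norm (f s)"] by simp
  have "((\<lambda>p. f (?b p)) has_sum (\<Sum>\<^sub>\<infinity>p\<in>?S. f (?b p))) ?S"
    using abs abs_summable_summable by (intro has_sum_infsum)
  moreover from has_sum_SigmaD[OF this in_sum]
  have "(\<lambda>n. q ^ (2 * n + 1) / odd_poch q z (Suc n)) sums (\<Sum>\<^sub>\<infinity>p\<in>?S. f (?b p))"
    by (intro has_sum_imp_sums) simp
  ultimately show "(f has_sum (\<Sum>n. q ^ (2 * n + 1) / odd_poch q z (Suc n))) (Collect odd_unimodal)"
    using has_sum_reindex_bij_betw[OF bij, of f] by (simp add: sums_iff)
qed

text \<open>Absolute summability over all sequences permits regrouping them by size and rank; the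
  fibres have \<open>ou m n\<close> elements.\<close>

lemma OU_eq_suminf:
  fixes q z :: complex
  assumes q: "norm q < 1" "q \<noteq> 0" and z: "norm z = 1"
  shows "OU z q = (\<Sum>n. q ^ (2 * n + 1) / odd_poch q z (Suc n))"
proof -
  define f where "f = (\<lambda>s. z powi unimodal_rank s * q ^ unimodal_size s)"
  define B where "B = (\<lambda>(n, m). {s. odd_unimodal s \<and> unimodal_size s = n \<and> unimodal_rank s = m})"
  have [simp]: "z \<noteq> 0" using z by auto
  have fs: "(\<lambda>s. norm (f s)) summable_on Collect odd_unimodal"
    "(f has_sum (\<Sum>n. q ^ (2 * n + 1) / odd_poch q z (Suc n))) (Collect odd_unimodal)"
    unfolding f_def by (rule has_sum_odd_unimodal[OF q(1) z])+
  have bij: "bij_betw snd (SIGMA p:UNIV. B p) (Collect odd_unimodal)"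
    by (rule bij_betw_byWitness[where f' = "\<lambda>s. ((unimodal_size s, unimodal_rank s), s)"])
       (auto simp: B_def)
  have sum: "((\<lambda>p. f (snd p)) has_sum (\<Sum>n. q ^ (2 * n + 1) / odd_poch q z (Suc n))) (SIGMA p:UNIV. B p)"
    using fs(2) has_sum_reindex_bij_betw[OF bij, of f] by simp
  have "((\<lambda>s. f (snd (p, s))) has_sum (case p of (n, m) \<Rightarrow> of_nat (ou m n) * z powi m * q ^ n)) (B p)" for p
  proof -
    obtain n m where p: "p = (n, m)" by fastforce
    have fB: "f s = z powi m * q ^ n" if "s \<in> B p" for s
      using that by (auto simp: B_def f_def p)
    \<comment> \<open>\<open>card\<close> would be 0 on an infinite fibre. The weight is constant
      and nonzero on a fibre, so summability forces finiteness.\<close>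
    have "finite (B p)"
    proof (rule ccontr)
      assume inf: "infinite (B p)"
      have "(\<lambda>s. norm (f s)) summable_on B p"
        using fs(1) by (rule summable_on_subset_banach) (auto simp: B_def p)
      also have "?this \<longleftrightarrow> (\<lambda>s. norm (z powi m * q ^ n)) summable_on B p"
        by (intro summable_on_cong) (simp add: fB)
      finally show False
        using infsum_diverge_constant[OF inf, of "norm (z powi m * q ^ n)"] q by simp
    qed
    then have "((\<lambda>s. z powi m * q ^ n) has_sum (of_nat (card (B p)) * (z powi m * q ^ n))) (B p)"
      by simp
    then show ?thesis
      using has_sum_cong[of "B p" f "\<lambda>_. z powi m * q ^ n"] fB
      by (simp add: p ou_def B_def mult.assoc)
  qed
  from has_sum_SigmaD[OF sum this] show ?thesis
    unfolding OU_def by (rule infsumI)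
qed

section \<open>The functional equation\<close>

lemma norm_one_minus_ge: "1 - norm w \<le> norm (1 - w)" for w :: "'a::real_normed_field"
  using norm_triangle_ineq2[of 1 w] by simp

text \<open>
  The factors \<open>1 - q\<^bsup>2k+1\<^esup> / z\<close> with \<open>k < N\<close> have \<open>|q\<^bsup>2k+1\<^esup> / z| = 1 / t\<close> for an odd power \<open>t < 1\<close> of \<open>|q|\<close>,
  and \<open>1 / t - 1 \<ge> 1 - t\<close>; hence the bound is uniform in both \<open>n\<close> and \<open>N\<close>.
\<close>

lemma odd_poch_norm_ge:
  assumes q: "0 < norm q" and z: "norm z = norm q ^ (2 * N)"
    and qq: "norm q < 1"
    and c: "0 < c" "\<And>A. finite A \<Longrightarrow> c \<le> (\<Prod>k\<in>A. 1 - norm q ^ (2 * k + 1))"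
  shows "c ^ 3 \<le> norm (odd_poch q z n)"
proof -
  let ?r = "norm q"
  let ?f = "\<lambda>k. 1 - ?r ^ (2 * k + 1)"
  have f: "0 \<le> ?f k" for k
    using qq by (simp add: power_le_one del: power_Suc)
  have z0: "z \<noteq> 0" using z q by auto
  have r1: "norm z \<le> 1" using z qq by (simp add: power_le_one)
  have 1: "(\<Prod>k<n. ?f k) \<le> norm (\<Prod>k<n. 1 - z * q ^ (2 * k + 1))"
    unfolding prod_norm[symmetric]
  proof (intro prod_mono conjI f)
    fix k
    have "norm (z * q ^ (2 * k + 1)) \<le> ?r ^ (2 * k + 1)"
      using r1 mult_right_mono[OF r1, of "?r ^ (2 * k + 1)"]
      by (simp add: norm_mult norm_power del: power_Suc)
    then show "?f k \<le> norm (1 - z * q ^ (2 * k + 1))"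
      using norm_one_minus_ge[of "z * q ^ (2 * k + 1)"] by linarith
  qed
  \<comment> \<open>For k < N the odd exponent 2k + 1 is reflected in 2N; for N \<le> k it is
    shifted down by 2N. Both maps are injective, so the bound c applies to each range.\<close>
  have low: "?f (N - 1 - k) \<le> norm (1 - q ^ (2 * k + 1) / z)" if k: "k < N" for k
  proof -
    define t where "t = ?r ^ (2 * (N - 1 - k) + 1)"
    have t: "0 < t" "t \<le> 1" using q qq by (auto simp: t_def power_le_one simp del: power_Suc)
    have "(2 * (N - 1 - k) + 1) + (2 * k + 1) = 2 * N" using k by simp
    then have "t * ?r ^ (2 * k + 1) = norm z"
      unfolding t_def z by (simp only: power_add[symmetric])
    then have "norm (q ^ (2 * k + 1) / z) = 1 / t"
      using t z0 by (simp add: norm_divide norm_power divide_simps mult.commute del: power_Suc)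
    moreover have "1 - t \<le> 1 / t - 1"
      using t zero_le_square[of "1 - t"] by (simp add: field_simps)
    moreover have "norm (q ^ (2 * k + 1) / z) - 1 \<le> norm (1 - q ^ (2 * k + 1) / z)"
      using norm_triangle_ineq2[of "q ^ (2 * k + 1) / z" 1] by (simp only: norm_one norm_minus_commute)
    ultimately show ?thesis by (simp add: t_def del: power_Suc)
  qed
  have high: "?f (k - N) \<le> norm (1 - q ^ (2 * k + 1) / z)" if k: "N \<le> k" for k
  proof -
    have "(2 * (k - N) + 1) + 2 * N = 2 * k + 1" using k by simp
    then have "?r ^ (2 * (k - N) + 1) * norm z = ?r ^ (2 * k + 1)"
      unfolding z by (simp only: power_add[symmetric])
    then have "norm (q ^ (2 * k + 1) / z) = ?r ^ (2 * (k - N) + 1)"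
      using z0 by (simp add: norm_divide norm_power field_simps del: power_Suc)
    then show ?thesis
      using norm_one_minus_ge[of "q ^ (2 * k + 1) / z"] by simp
  qed
  have 2: "c \<le> norm (\<Prod>k\<in>{..<n} \<inter> {..<N}. 1 - q ^ (2 * k + 1) / z)"
  proof -
    have inj: "inj_on (\<lambda>k. N - 1 - k) ({..<n} \<inter> {..<N})" by (auto simp: inj_on_def)
    have "c \<le> (\<Prod>k\<in>(\<lambda>k. N - 1 - k) ` ({..<n} \<inter> {..<N}). ?f k)" by (rule c) simp
    also have "\<dots> = (\<Prod>k\<in>{..<n} \<inter> {..<N}. ?f (N - 1 - k))"
      by (subst prod.reindex[OF inj]) (simp add: o_def)
    also have "\<dots> \<le> norm (\<Prod>k\<in>{..<n} \<inter> {..<N}. 1 - q ^ (2 * k + 1) / z)"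
      unfolding prod_norm[symmetric] by (intro prod_mono conjI f low) simp
    finally show ?thesis .
  qed
  have 3: "c \<le> norm (\<Prod>k\<in>{..<n} - {..<N}. 1 - q ^ (2 * k + 1) / z)"
  proof -
    have inj: "inj_on (\<lambda>k. k - N) ({..<n} - {..<N})" by (auto simp: inj_on_def)
    have "c \<le> (\<Prod>k\<in>(\<lambda>k. k - N) ` ({..<n} - {..<N}). ?f k)" by (rule c) simp
    also have "\<dots> = (\<Prod>k\<in>{..<n} - {..<N}. ?f (k - N))"
      by (subst prod.reindex[OF inj]) (simp add: o_def)
    also have "\<dots> \<le> norm (\<Prod>k\<in>{..<n} - {..<N}. 1 - q ^ (2 * k + 1) / z)"
      unfolding prod_norm[symmetric] by (intro prod_mono conjI f high) simp
    finally show ?thesis .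
  qed
  have "odd_poch q z n = (\<Prod>k<n. 1 - z * q ^ (2 * k + 1)) *
     ((\<Prod>k\<in>{..<n} \<inter> {..<N}. 1 - q ^ (2 * k + 1) / z) *
      (\<Prod>k\<in>{..<n} - {..<N}. 1 - q ^ (2 * k + 1) / z))"
    unfolding odd_poch_def prod.distrib by (subst prod.Int_Diff[of "{..<n}" _ "{..<N}"]) auto
  moreover have "c * (c * c) \<le> norm (\<Prod>k<n. 1 - z * q ^ (2 * k + 1)) *
     (norm (\<Prod>k\<in>{..<n} \<inter> {..<N}. 1 - q ^ (2 * k + 1) / z) *
      norm (\<Prod>k\<in>{..<n} - {..<N}. 1 - q ^ (2 * k + 1) / z))"
    using c(1) c(2)[of "{..<n}"] 1 2 3 by (intro mult_mono) auto
  ultimately show ?thesis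
    by (simp only: norm_mult power3_eq_cube mult.assoc)
qed

section \<open>Infinite products\<close>

lemma qpoch_inf_LIMSEQ:
  assumes "norm p < 1"
  shows "(\<lambda>n. \<Prod>k<n. 1 - z * p ^ k) \<longlonglongrightarrow> qpoch_inf z p"
    and "(\<And>k. z * p ^ k \<noteq> 1) \<Longrightarrow> qpoch_inf z p \<noteq> 0"
proof -
  have "summable (\<lambda>k. norm z * norm p ^ k)"
    using assms by (intro summable_mult summable_geometric) simp
  then have cv: "convergent_prod (\<lambda>k. 1 - z * p ^ k)"
    by (intro abs_convergent_prod_imp_convergent_prod summable_imp_abs_convergent_prod)
       (simp add: norm_mult norm_power)
  show "(\<lambda>n. \<Prod>k<n. 1 - z * p ^ k) \<longlonglongrightarrow> qpoch_inf z p"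
    using has_prod_imp_tendsto'[OF convergent_prod_has_prod[OF cv]] by (simp add: qpoch_inf_def)
  show "qpoch_inf z p \<noteq> 0" if "\<And>k. z * p ^ k \<noteq> 1"
    unfolding qpoch_inf_def using that by (intro prodinf_nonzero[OF cv]) simp
qed

lemma odd_poch_LIMSEQ:
  assumes "norm q < 1"
  shows "odd_poch q z \<longlonglongrightarrow> qpoch_inf (z * q) (q\<^sup>2) * qpoch_inf (q / z) (q\<^sup>2)"
proof -
  have p: "norm (q\<^sup>2) < 1" using assms by (simp add: norm_power power_less_one_iff)
  have "odd_poch q z = (\<lambda>n. (\<Prod>k<n. 1 - z * q * (q\<^sup>2) ^ k) * (\<Prod>k<n. 1 - q / z * (q\<^sup>2) ^ k))"
    by (rule ext) (simp add: odd_poch_def prod.distrib power_mult mult.assoc)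
  then show ?thesis
    by (simp only:) (intro tendsto_mult qpoch_inf_LIMSEQ p)
qed

text \<open>The first 2n factors split by the parity of the exponent, and these partial products
  form a subsequence with the same limit.\<close>

lemma qpoch_inf_even_odd:
  assumes "norm q < 1"
  shows "qpoch_inf z q = qpoch_inf z (q\<^sup>2) * qpoch_inf (z * q) (q\<^sup>2)"
proof (rule LIMSEQ_unique)
  have p: "norm (q\<^sup>2) < 1" using assms by (simp add: norm_power power_less_one_iff)
  have eq: "(\<Prod>k<2 * n. 1 - z * q ^ k) = (\<Prod>k<n. 1 - z * (q\<^sup>2) ^ k) * (\<Prod>k<n. 1 - z * q * (q\<^sup>2) ^ k)" for n
    by (induction n) (simp_all add: power_mult[symmetric] mult_ac del: power_mult)
  show "(\<lambda>n. \<Prod>k<2 * n. 1 - z * q ^ k) \<longlonglongrightarrow> qpoch_inf z q"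
    using LIMSEQ_subseq_LIMSEQ[OF qpoch_inf_LIMSEQ(1)[OF assms], of "\<lambda>n. 2 * n" z]
    by (simp add: o_def strict_mono_def)
  show "(\<lambda>n. \<Prod>k<2 * n. 1 - z * q ^ k) \<longlonglongrightarrow> qpoch_inf z (q\<^sup>2) * qpoch_inf (z * q) (q\<^sup>2)"
    unfolding eq by (intro tendsto_mult qpoch_inf_LIMSEQ p)
qed

section \<open>The partial theta function and \<open>H1\<close> under z \<rightarrow> z q^2\<close>

text \<open>The half m = n + 1/2 > 0 of a theta series: the terms are (-1)^n z^(2m) q^(m^2 -
  1/4).\<close>

definition partial_theta :: "complex \<Rightarrow> complex \<Rightarrow> complex" where
  "partial_theta z q = (\<Sum>n. (-1) ^ n * z ^ (2 * n + 1) * q ^ (n\<^sup>2 + n))"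

text \<open>The majorant does not depend on z in the closed unit disc; the iteration along z q^(2N)
  relies on this uniformity.\<close>

lemma partial_theta_summable:
  assumes q: "norm q < 1" and z: "norm z \<le> 1"
  shows "norm ((-1) ^ n * z ^ (2 * n + 1) * q ^ (n\<^sup>2 + n)) \<le> norm q ^ n"
    and "summable (\<lambda>n. (-1) ^ n * z ^ (2 * n + 1) * q ^ (n\<^sup>2 + n))"
    and "norm (partial_theta z q) \<le> 1 / (1 - norm q)"
proof -
  have geo: "summable (\<lambda>n. norm q ^ n)" using q by (simp add: summable_geometric)
  show le: "norm ((-1) ^ n * z ^ (2 * n + 1) * q ^ (n\<^sup>2 + n)) \<le> norm q ^ n" for n
  proof -
    have "norm z ^ (2 * n + 1) * norm q ^ (n\<^sup>2 + n) \<le> 1 * norm q ^ n"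
      using q z by (intro mult_mono power_le_one power_decreasing) auto
    then show ?thesis by (simp add: norm_mult norm_power del: power_Suc)
  qed
  show "summable (\<lambda>n. (-1) ^ n * z ^ (2 * n + 1) * q ^ (n\<^sup>2 + n))"
    by (rule summable_comparison_test'[OF geo le])
  show "norm (partial_theta z q) \<le> 1 / (1 - norm q)"
    unfolding partial_theta_def
    using norm_suminf_le[OF le geo] suminf_geometric[of "norm q"] q by simp
qed

lemma H1_summable:
  assumes q: "norm q < 1" and z: "norm z \<le> 1"
  shows "summable (\<lambda>n. (-1) ^ (n + 1) * z ^ (3 * n + 1) * q ^ (3 * n\<^sup>2 + 2 * n) * (1 + z * q ^ (2 * n + 1)))"
    and "norm (H1 z q) \<le> 2 / (1 - norm q)"
proof -
  have geo: "summable (\<lambda>n. norm q ^ n * 2)" using q by (intro summable_mult2 summable_geometric) simp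
  have le: "norm ((-1) ^ (n + 1) * z ^ (3 * n + 1) * q ^ (3 * n\<^sup>2 + 2 * n) * (1 + z * q ^ (2 * n + 1)))
    \<le> norm q ^ n * 2" for n
  proof -
    have "norm (z * q ^ (2 * n + 1)) \<le> 1 * 1"
      unfolding norm_mult norm_power using q z by (intro mult_mono power_le_one) auto
    then have "norm (1 + z * q ^ (2 * n + 1)) \<le> 2"
      using norm_triangle_ineq[of 1 "z * q ^ (2 * n + 1)"] by (simp del: power_Suc)
    then have "norm z ^ (3 * n + 1) * norm q ^ (3 * n\<^sup>2 + 2 * n) * norm (1 + z * q ^ (2 * n + 1))
      \<le> 1 * norm q ^ n * 2"
      using q z by (intro mult_mono power_le_one power_decreasing mult_nonneg_nonneg) auto
    then show ?thesis by (simp add: norm_mult norm_power del: power_Suc)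
  qed
  show "summable (\<lambda>n. (-1) ^ (n + 1) * z ^ (3 * n + 1) * q ^ (3 * n\<^sup>2 + 2 * n) * (1 + z * q ^ (2 * n + 1)))"
    by (rule summable_comparison_test'[OF geo le])
  show "norm (H1 z q) \<le> 2 / (1 - norm q)"
    unfolding H1_def
    using norm_suminf_le[OF le geo] suminf_geometric[of "norm q"] suminf_mult2[of "\<lambda>n. norm q ^ n" 2] q
    by (simp add: summable_geometric)
qed

text \<open>Replacing z by z q^2 corresponds to raising the summation index by two, so the first two
  terms split off.\<close>

lemma partial_theta_shift:
  assumes q: "norm q < 1" and z: "norm z \<le> 1"
  shows "partial_theta z q = z - z ^ 3 * q ^ 2 + z ^ 4 * q ^ 4 * partial_theta (z * q\<^sup>2) q"
proof -
  let ?f = "\<lambda>n. (-1) ^ n * z ^ (2 * n + 1) * q ^ (n\<^sup>2 + n)"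
  let ?g = "\<lambda>n. (-1) ^ n * (z * q\<^sup>2) ^ (2 * n + 1) * q ^ (n\<^sup>2 + n)"
  have zq: "norm (z * q\<^sup>2) \<le> 1"
    unfolding norm_mult norm_power using q z mult_mono[of "norm z" 1 "norm q ^ 2" 1]
    by (simp add: power_le_one)
  have "?f (n + 2) = z ^ 4 * q ^ 4 * ?g n" for n
  proof -
    have "(n + 2)\<^sup>2 + (n + 2) = 4 + 2 * (2 * n + 1) + (n\<^sup>2 + n)" by (simp add: power2_eq_square)
    then have "q ^ ((n + 2)\<^sup>2 + (n + 2)) = q ^ 4 * (q\<^sup>2) ^ (2 * n + 1) * q ^ (n\<^sup>2 + n)"
      by (simp only: power_add power_mult)
    moreover have "2 * (n + 2) + 1 = 4 + (2 * n + 1)" by simp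
    then have "z ^ (2 * (n + 2) + 1) = z ^ 4 * z ^ (2 * n + 1)"
      using power_add[of z 4 "2 * n + 1"] by (simp only: \<open>2 * (n + 2) + 1 = 4 + (2 * n + 1)\<close>)
    ultimately show ?thesis
      by (simp only: power_mult_distrib) (simp add: power_add mult_ac)
  qed
  then have "(\<Sum>n. ?f (n + 2)) = z ^ 4 * q ^ 4 * partial_theta (z * q\<^sup>2) q"
    unfolding partial_theta_def by (simp only: suminf_mult[OF partial_theta_summable(2)[OF q zq]])
  then show ?thesis
    using suminf_split_initial_segment[OF partial_theta_summable(2)[OF q z], of 2]
    unfolding partial_theta_def by (simp add: numeral_2_eq_2 eval_nat_numeral)
qed

text \<open>Here z \<rightarrow> z q^2 raises the index by only one. The term that splits off, -z(1
  + zq), is the boundary term of the telescoping sum below.\<close>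

lemma H1_shift:
  assumes q: "norm q < 1" and z: "norm z \<le> 1"
  shows "H1 z q = - z * (1 + z * q) - z ^ 3 * q ^ 3 * H1 (z * q\<^sup>2) q"
proof -
  let ?f = "\<lambda>z n. (-1) ^ (n + 1) * z ^ (3 * n + 1) * q ^ (3 * n\<^sup>2 + 2 * n) * (1 + z * q ^ (2 * n + 1))"
  have zq: "norm (z * q\<^sup>2) \<le> 1"
    unfolding norm_mult norm_power using q z mult_mono[of "norm z" 1 "norm q ^ 2" 1]
    by (simp add: power_le_one)
  have "?f z (n + 1) = - (z ^ 3 * q ^ 3) * ?f (z * q\<^sup>2) n" for n
  proof -
    have "3 * (n + 1)\<^sup>2 + 2 * (n + 1) = 3 + 2 * (3 * n + 1) + (3 * n\<^sup>2 + 2 * n)"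
      by (simp add: power2_eq_square)
    then have "q ^ (3 * (n + 1)\<^sup>2 + 2 * (n + 1)) = q ^ 3 * (q\<^sup>2) ^ (3 * n + 1) * q ^ (3 * n\<^sup>2 + 2 * n)"
      by (simp only: power_add power_mult)
    moreover have "z ^ (3 * (n + 1) + 1) = z ^ 3 * z ^ (3 * n + 1)"
      by (simp add: power_add eval_nat_numeral)
    moreover have "q ^ (2 * (n + 1) + 1) = q\<^sup>2 * q ^ (2 * n + 1)"
      by (simp add: power_add power2_eq_square)
    ultimately show ?thesis
      by (simp only: power_mult_distrib) (simp add: mult_ac)
  qed
  then have "(\<Sum>n. ?f z (n + 1)) = - (z ^ 3 * q ^ 3) * H1 (z * q\<^sup>2) q"
    unfolding H1_def by (simp only: suminf_mult[OF H1_summable(1)[OF q zq]])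
  then show ?thesis
    using suminf_split_initial_segment[OF H1_summable(1)[OF q z], of 1]
    unfolding H1_def by simp
qed

section \<open>The sum over peaks under z \<rightarrow> z q^2\<close>

text \<open>The substitution moves the range of the factors in z up and that of the factors in 1/z
  down by one place, so only boundary factors differ. They are cross-multiplied to avoid
  division.\<close>

lemma odd_poch_shift:
  assumes z: "z \<noteq> 0" and q: "q \<noteq> 0"
  shows "odd_poch q (z * q\<^sup>2) (Suc n) * ((1 - z * q) * (1 - q ^ (2 * n + 1) / z)) =
    odd_poch q z (Suc n) * ((1 - z * q ^ (2 * n + 3)) * (1 - 1 / (z * q)))"
proof (induction n)
  case 0
  show ?case
    using z q by (simp add: odd_poch_Suc) (simp add: eval_nat_numeral field_simps)
next
  case (Suc n)
  have 1: "q ^ (2 * Suc n + 1) / (z * q\<^sup>2) = q ^ (2 * n + 1) / z"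
    using z q by (simp add: field_simps eval_nat_numeral)
  have 2: "z * q\<^sup>2 * q ^ (2 * Suc n + 1) = z * q ^ (2 * Suc n + 3)"
    by (simp add: eval_nat_numeral)
  have 3: "z * q ^ (2 * n + 3) = z * q ^ (2 * Suc n + 1)"
    by (simp add: eval_nat_numeral)
  have "odd_poch q (z * q\<^sup>2) (Suc (Suc n)) * ((1 - z * q) * (1 - q ^ (2 * Suc n + 1) / z)) =
    (odd_poch q (z * q\<^sup>2) (Suc n) * ((1 - z * q) * (1 - q ^ (2 * n + 1) / z))) *
    ((1 - z * q ^ (2 * Suc n + 3)) * (1 - q ^ (2 * Suc n + 1) / z))"
    unfolding odd_poch_Suc[of _ _ "Suc n"] 1 2 by (simp only: mult_ac)
  also have "\<dots> = odd_poch q z (Suc n) * ((1 - z * q ^ (2 * Suc n + 1)) * (1 - q ^ (2 * Suc n + 1) / z)) *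
     ((1 - z * q ^ (2 * Suc n + 3)) * (1 - 1 / (z * q)))"
    unfolding Suc 3 by (simp only: mult_ac)
  finally show ?case unfolding odd_poch_Suc[of _ _ "Suc n"] .
qed

text \<open>
  With \<open>V n = 1 / ((zq; q\<^sup>2)\<^bsub>n+1\<^esub> (q/z; q\<^sup>2)\<^bsub>n\<^esub>)\<close>, the summand is \<open>z (1 - z\<^sup>2 q\<^sup>2) (V (n + 1) - V n)\<close>.
\<close>

lemma odd_poch_telescope:
  assumes q: "q \<noteq> 0" and z: "z \<noteq> 0"
    and nz: "\<And>n. odd_poch q z n \<noteq> 0" "\<And>n. odd_poch q (z * q\<^sup>2) n \<noteq> 0"
  shows "(\<Sum>n<M. q ^ (2 * n + 1) / odd_poch q z (Suc n) +
      z ^ 3 * q ^ 3 * (q ^ (2 * n + 1) / odd_poch q (z * q\<^sup>2) (Suc n))) =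
    z * (1 - z\<^sup>2 * q\<^sup>2) * (1 / (odd_poch q z M * (1 - z * q ^ (2 * M + 1))) - 1 / (1 - z * q))"
proof (induction M)
  case 0
  show ?case by simp
next
  case (Suc n)
  define X where "X = q ^ (2 * n + 1)"
  define D where "D = odd_poch q z n"
  have f: "1 - z * q ^ (2 * k + 1) \<noteq> 0" "1 - q ^ (2 * k + 1) / z \<noteq> 0" for k
    using nz(1)[of "Suc k"] by (auto simp: odd_poch_Suc)
  have X: "1 - z * X \<noteq> 0" "1 - X / z \<noteq> 0" "1 - z * q \<noteq> 0" "1 - z * X * q\<^sup>2 \<noteq> 0" "D \<noteq> 0" "X \<noteq> 0"
    using f[of n] f[of 0] f[of "Suc n"] nz(1) q by (auto simp: X_def D_def eval_nat_numeral mult_ac)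
  have e3: "z * q ^ (2 * n + 3) = z * X * q\<^sup>2" "z * q ^ (2 * Suc n + 1) = z * X * q\<^sup>2"
    by (simp_all add: X_def eval_nat_numeral mult_ac)
  have D1: "odd_poch q z (Suc n) = D * ((1 - z * X) * (1 - X / z))"
    unfolding D_def X_def by (rule odd_poch_Suc)
  have D2: "odd_poch q (z * q\<^sup>2) (Suc n) * ((1 - z * q) * (1 - X / z)) =
    D * ((1 - z * X) * (1 - X / z)) * ((1 - z * X * q\<^sup>2) * (1 - 1 / (z * q)))"
    using odd_poch_shift[OF z q, of n] unfolding e3 D1 X_def[symmetric] .
  then have "odd_poch q (z * q\<^sup>2) (Suc n) * (1 - z * q) * (1 - X / z) =
    D * (1 - z * X) * ((1 - z * X * q\<^sup>2) * (1 - 1 / (z * q))) * (1 - X / z)"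
    by (simp only: mult_ac)
  then have "odd_poch q (z * q\<^sup>2) (Suc n) * (1 - z * q) =
    D * (1 - z * X) * ((1 - z * X * q\<^sup>2) * (1 - 1 / (z * q)))"
    by (simp only: mult_right_cancel[OF X(2)])
  \<comment> \<open>Since 1 - 1/(zq) = -(1 - zq)/(zq), the factor 1 - zq can be cancelled on both
    sides.\<close>
  also have "\<dots> = (1 - z * q) * (- (D * (1 - z * X) * (1 - z * X * q\<^sup>2)) / (z * q))"
    using z q by (simp add: divide_simps) (simp add: algebra_simps)
  finally have D3: "odd_poch q (z * q\<^sup>2) (Suc n) = - (D * (1 - z * X) * (1 - z * X * q\<^sup>2)) / (z * q)"
    by (simp only: mult.commute[of "1 - z * q"] mult_right_cancel[OF X(3)])
  \<comment> \<open>A is the reciprocal of V n and \<open>A * (W / z) * Y\<close> that of V (n + 1).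
    After clearing denominators, one telescoping step is a polynomial identity in z, q and
    X.\<close>
  define A where "A = D * (1 - z * X)"
  define W where "W = z - X"
  define Y where "Y = 1 - z * X * q\<^sup>2"
  have AWY: "A \<noteq> 0" "W \<noteq> 0" "Y \<noteq> 0"
    using X z by (auto simp: A_def W_def Y_def)
  have W: "1 - X / z = W / z" using z by (simp add: W_def diff_divide_distrib)
  have "X / (A * (W / z)) + z ^ 3 * q ^ 3 * (X / (- (A * Y) / (z * q))) =
      (X * z * Y - z ^ 4 * q ^ 4 * X * W) / (A * W * Y)"
    using AWY z q by (simp add: divide_simps) (simp add: eval_nat_numeral algebra_simps)
  also have "X * z * Y - z ^ 4 * q ^ 4 * X * W = z * (1 - z\<^sup>2 * q\<^sup>2) * (z - W * Y)"
    by (simp add: Y_def W_def eval_nat_numeral algebra_simps)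
  also have "\<dots> / (A * W * Y) = z * (1 - z\<^sup>2 * q\<^sup>2) * (1 / (A * (W / z) * Y) - 1 / A)"
    using AWY z q by (simp add: divide_simps)
  finally have step: "X / (A * (W / z)) + z ^ 3 * q ^ 3 * (X / (- (A * Y) / (z * q))) =
    z * (1 - z\<^sup>2 * q\<^sup>2) * (1 / (A * (W / z) * Y) - 1 / A)" .
  have D1': "odd_poch q z (Suc n) = A * (W / z)"
    unfolding D1 A_def W by (simp only: mult.assoc)
  have D3': "odd_poch q (z * q\<^sup>2) (Suc n) = - (A * Y) / (z * q)"
    unfolding D3 A_def Y_def ..
  show ?case
    unfolding sum.lessThan_Suc Suc.IH D1' D3' e3 X_def[symmetric] D_def[symmetric]
      A_def[symmetric] Y_def[symmetric] step
    by (simp add: algebra_simps)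
qed

lemma odd_poch_suminf_bound:
  assumes q: "norm q < 1" and k: "0 < k" "\<And>n. k \<le> norm (odd_poch q z n)"
  shows "summable (\<lambda>n. q ^ (2 * n + 1) / odd_poch q z (Suc n))"
    and "norm (\<Sum>n. q ^ (2 * n + 1) / odd_poch q z (Suc n)) \<le> 1 / (1 - norm q) / k"
proof -
  have geo: "summable (\<lambda>n. norm q ^ n / k)"
    using q by (intro summable_divide summable_geometric) simp
  have le: "norm (q ^ (2 * n + 1) / odd_poch q z (Suc n)) \<le> norm q ^ n / k" for n
    unfolding norm_divide norm_power
    using q k by (intro frac_le power_decreasing zero_le_power norm_ge_zero) auto
  show "summable (\<lambda>n. q ^ (2 * n + 1) / odd_poch q z (Suc n))"
    by (rule summable_comparison_test'[OF geo le])
  show "norm (\<Sum>n. q ^ (2 * n + 1) / odd_poch q z (Suc n)) \<le> 1 / (1 - norm q) / k"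
    using norm_suminf_le[OF le geo] suminf_geometric[of "norm q"]
      suminf_divide[of "\<lambda>n. norm q ^ n" k] q
    by (simp add: summable_geometric)
qed

definition odd_poch_inf :: "complex \<Rightarrow> complex \<Rightarrow> complex" where
  "odd_poch_inf q z = qpoch_inf (z * q) (q\<^sup>2) * qpoch_inf (q / z) (q\<^sup>2)"

lemma odd_poch_inf_ge:
  assumes q: "norm q < 1" and k: "\<And>n. k \<le> norm (odd_poch q z n)"
  shows "k \<le> norm (odd_poch_inf q z)"
  using tendsto_norm[OF odd_poch_LIMSEQ[OF q, of z]] k
  unfolding odd_poch_inf_def by (intro LIMSEQ_le_const) auto

lemma odd_power_LIMSEQ_zero:
  assumes "norm (q :: complex) < 1"
  shows "(\<lambda>n. q ^ (2 * n + c)) \<longlonglongrightarrow> 0"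
proof -
  have "(\<lambda>n. q ^ (2 * n)) \<longlonglongrightarrow> 0"
    using LIMSEQ_subseq_LIMSEQ[OF LIMSEQ_power_zero[OF assms], of "\<lambda>n. 2 * n"]
    by (simp add: o_def strict_mono_def)
  from tendsto_mult_right[OF this, of "q ^ c"] show ?thesis
    by (simp add: power_add)
qed

text \<open>The limit of \<open>odd_poch_shift\<close>: the boundary factors containing n tend to 1,
  and the remaining two have quotient -1/(zq).\<close>

lemma odd_poch_inf_shift:
  assumes q: "q \<noteq> 0" "norm q < 1" and z: "z \<noteq> 0" and zq: "z * q \<noteq> 1"
  shows "odd_poch_inf q (z * q\<^sup>2) = - odd_poch_inf q z / (z * q)"
proof -
  have zq': "1 - z * q \<noteq> 0" using zq by simp
  have L: "(\<lambda>n. odd_poch q z (Suc n)) \<longlonglongrightarrow> odd_poch_inf q z" for z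
    using LIMSEQ_Suc[OF odd_poch_LIMSEQ[OF q(2)]] by (simp add: odd_poch_inf_def)
  have "(\<lambda>n. odd_poch q (z * q\<^sup>2) (Suc n) * ((1 - z * q) * (1 - q ^ (2 * n + 1) / z)))
     \<longlonglongrightarrow> odd_poch_inf q (z * q\<^sup>2) * ((1 - z * q) * (1 - 0 / z))"
    using z by (intro tendsto_intros L odd_power_LIMSEQ_zero q)
  moreover have "(\<lambda>n. odd_poch q z (Suc n) * ((1 - z * q ^ (2 * n + 3)) * (1 - 1 / (z * q))))
     \<longlonglongrightarrow> odd_poch_inf q z * ((1 - z * 0) * (1 - 1 / (z * q)))"
    by (intro tendsto_intros L odd_power_LIMSEQ_zero q)
  ultimately have "odd_poch_inf q (z * q\<^sup>2) * (1 - z * q) = odd_poch_inf q z * (1 - 1 / (z * q))"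
    unfolding odd_poch_shift[OF z q(1)] using LIMSEQ_unique by fastforce
  also have "\<dots> = (- odd_poch_inf q z / (z * q)) * (1 - z * q)"
    using z q by (simp add: divide_simps) (simp add: algebra_simps)
  finally show ?thesis
    by (simp only: mult_right_cancel[OF zq'])
qed

text \<open>The telescoping sum in the limit: the upper end gives the infinite product. At the lower
  end 1 - z^2 q^2 = (1 + zq)(1 - zq) cancels the denominator 1 - zq.\<close>

lemma odd_poch_suminf_shift:
  assumes q: "q \<noteq> 0" "norm q < 1" and z: "z \<noteq> 0"
    and k: "0 < k" "\<And>n. k \<le> norm (odd_poch q z n)" "\<And>n. k \<le> norm (odd_poch q (z * q\<^sup>2) n)"
  defines "F \<equiv> \<lambda>z. \<Sum>n. q ^ (2 * n + 1) / odd_poch q z (Suc n)"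
  shows "F z + z ^ 3 * q ^ 3 * F (z * q\<^sup>2) =
    z * (1 - z\<^sup>2 * q\<^sup>2) / odd_poch_inf q z - z * (1 + z * q)"
proof -
  have P: "odd_poch_inf q z \<noteq> 0"
    using odd_poch_inf_ge[OF q(2) k(2)] k(1) by auto
  have nz: "odd_poch q z n \<noteq> 0" "odd_poch q (z * q\<^sup>2) n \<noteq> 0" for n
    using k(1) k(2,3)[of n] by auto
  have zq: "1 - z * q \<noteq> 0"
    using nz(1)[of 1] by (auto simp: odd_poch_def)
  have s: "summable (\<lambda>n. q ^ (2 * n + 1) / odd_poch q z (Suc n))"
     "summable (\<lambda>n. q ^ (2 * n + 1) / odd_poch q (z * q\<^sup>2) (Suc n))"
    by (rule odd_poch_suminf_bound[OF q(2) k(1)], rule k)+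
  have "(\<lambda>n. q ^ (2 * n + 1) / odd_poch q z (Suc n) +
      z ^ 3 * q ^ 3 * (q ^ (2 * n + 1) / odd_poch q (z * q\<^sup>2) (Suc n))) sums
      (F z + z ^ 3 * q ^ 3 * F (z * q\<^sup>2))"
    unfolding F_def by (intro sums_add sums_mult summable_sums s)
  then have "(\<lambda>M. z * (1 - z\<^sup>2 * q\<^sup>2) *
     (1 / (odd_poch q z M * (1 - z * q ^ (2 * M + 1))) - 1 / (1 - z * q)))
     \<longlonglongrightarrow> F z + z ^ 3 * q ^ 3 * F (z * q\<^sup>2)"
    unfolding sums_def odd_poch_telescope[OF q(1) z nz] .
  moreover have "(\<lambda>M. z * (1 - z\<^sup>2 * q\<^sup>2) *
     (1 / (odd_poch q z M * (1 - z * q ^ (2 * M + 1))) - 1 / (1 - z * q)))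
     \<longlonglongrightarrow> z * (1 - z\<^sup>2 * q\<^sup>2) * (1 / (odd_poch_inf q z * (1 - z * 0)) - 1 / (1 - z * q))"
    unfolding odd_poch_inf_def
    by (intro tendsto_intros odd_poch_LIMSEQ odd_power_LIMSEQ_zero q)
       (use P in \<open>simp add: odd_poch_inf_def\<close>)
  ultimately have "F z + z ^ 3 * q ^ 3 * F (z * q\<^sup>2) =
     z * (1 - z\<^sup>2 * q\<^sup>2) * (1 / (odd_poch_inf q z * (1 - z * 0)) - 1 / (1 - z * q))"
    by (rule LIMSEQ_unique)
  also have "\<dots> = z * (1 - z\<^sup>2 * q\<^sup>2) / odd_poch_inf q z - z * (1 - z\<^sup>2 * q\<^sup>2) * (1 / (1 - z * q))"
    by (simp add: right_diff_distrib)
  also have "1 - z\<^sup>2 * q\<^sup>2 = (1 + z * q) * (1 - z * q)"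
    by (simp add: algebra_simps power2_eq_square)
  also have "z * ((1 + z * q) * (1 - z * q)) * (1 / (1 - z * q)) = z * (1 + z * q)"
    using zq by simp
  finally show ?thesis by (simp only: \<open>1 - z\<^sup>2 * q\<^sup>2 = (1 + z * q) * (1 - z * q)\<close>)
qed

section \<open>Uniqueness by iterating the functional equation\<close>

lemma odd_poch_suminf_eq:
  assumes q: "q \<noteq> 0" "norm q < 1" and z: "norm z = 1"
  shows "(\<Sum>n. q ^ (2 * n + 1) / odd_poch q z (Suc n)) = partial_theta z q / odd_poch_inf q z + H1 z q"
proof -
  obtain c where c: "0 < c" "\<And>A. finite A \<Longrightarrow> c \<le> (\<Prod>k\<in>A. 1 - norm q ^ (2 * k + 1))"
    using odd_prod_bounded_below[of "norm q"] q by auto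
  define E where "E z = (\<Sum>n. q ^ (2 * n + 1) / odd_poch q z (Suc n)) - H1 z q
    - partial_theta z q / odd_poch_inf q z" for z
  \<comment> \<open>C adds the bounds for the sum over peaks, for \<open>H1\<close> and for the
    partial theta quotient; none of them depends on N.\<close>
  define C where "C = 1 / (1 - norm q) / c ^ 3 + 2 / (1 - norm q) + 1 / (1 - norm q) / c ^ 3"
  have k: "c ^ 3 \<le> norm (odd_poch q z n)" if "norm z = norm q ^ (2 * N)" for z N n
    by (rule odd_poch_norm_ge[OF _ that q(2) c]) (use q in simp)
  have c3: "0 < c ^ 3" using c(1) by simp
  have step: "norm (E z) \<le> C" "E z = - (z ^ 3 * q ^ 3) * E (z * q\<^sup>2)"
    if N: "norm z = norm q ^ (2 * N)" for z N
  proof -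
    have z1: "norm z \<le> 1" and z0: "z \<noteq> 0"
      using N q by (auto simp: power_le_one)
    have kz: "c ^ 3 \<le> norm (odd_poch q z n)" for n by (rule k[OF N])
    have "norm (z * q\<^sup>2) = norm q ^ (2 * Suc N)"
      using N by (simp add: norm_mult norm_power power_add power2_eq_square)
    then have kzq: "c ^ 3 \<le> norm (odd_poch q (z * q\<^sup>2) n)" for n by (rule k)
    have P: "c ^ 3 \<le> norm (odd_poch_inf q z)" by (rule odd_poch_inf_ge[OF q(2) kz])
    then have P0: "odd_poch_inf q z \<noteq> 0" using c3 by auto
    have zq: "z * q \<noteq> 1"
      using kz[of 1] c3 by (auto simp: odd_poch_def)
    have "norm (partial_theta z q / odd_poch_inf q z) \<le> 1 / (1 - norm q) / c ^ 3"
      unfolding norm_divide using partial_theta_summable(3)[OF q(2) z1] P c3 q(2)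
      by (intro frac_le) auto
    then show "norm (E z) \<le> C"
      unfolding E_def C_def
      using H1_summable(2)[OF q(2) z1] odd_poch_suminf_bound(2)[OF q(2) c3 kz]
      by (intro order.trans[OF norm_triangle_ineq4] add_mono) auto
    \<comment> \<open>The shift of the infinite product contributes -zq, which turns the coefficient
      z^4 q^4 of the partial theta function into the common -z^3 q^3.\<close>
    have "partial_theta (z * q\<^sup>2) q / odd_poch_inf q (z * q\<^sup>2) * (z ^ 3 * q ^ 3) =
      - (z ^ 4 * q ^ 4 * partial_theta (z * q\<^sup>2) q) / odd_poch_inf q z"
      unfolding odd_poch_inf_shift[OF q z0 zq] using P0 z0 q
      by (simp add: field_simps eval_nat_numeral)
    also have "\<dots> = z * (1 - z\<^sup>2 * q\<^sup>2) / odd_poch_inf q z - partial_theta z q / odd_poch_inf q z"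
      unfolding partial_theta_shift[OF q(2) z1]
      by (simp add: diff_divide_distrib[symmetric]) (simp add: algebra_simps eval_nat_numeral)
    finally have S: "partial_theta (z * q\<^sup>2) q / odd_poch_inf q (z * q\<^sup>2) * (z ^ 3 * q ^ 3) =
      z * (1 - z\<^sup>2 * q\<^sup>2) / odd_poch_inf q z - partial_theta z q / odd_poch_inf q z" .
    show "E z = - (z ^ 3 * q ^ 3) * E (z * q\<^sup>2)"
    proof -
      have F: "(\<Sum>n. q ^ (2 * n + 1) / odd_poch q z (Suc n)) =
        z * (1 - z\<^sup>2 * q\<^sup>2) / odd_poch_inf q z - z * (1 + z * q) -
        z ^ 3 * q ^ 3 * (\<Sum>n. q ^ (2 * n + 1) / odd_poch q (z * q\<^sup>2) (Suc n))"
        using odd_poch_suminf_shift[OF q z0 c3 kz kzq] by (simp only: eq_diff_eq)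
      have T: "partial_theta z q / odd_poch_inf q z = z * (1 - z\<^sup>2 * q\<^sup>2) / odd_poch_inf q z -
        partial_theta (z * q\<^sup>2) q / odd_poch_inf q (z * q\<^sup>2) * (z ^ 3 * q ^ 3)"
        unfolding S by simp
      \<comment> \<open>The inhomogeneous terms cancel: K between the sum over peaks and the partial
        theta quotient, b between the sum over peaks and \<open>H1\<close>.\<close>
      have "K - b - w * F' - (- b - w * H') - (K - T' * w) = - (w * (F' - H' - T'))"
        for K b w F' H' T' :: complex
        by (simp add: algebra_simps)
      then show ?thesis
        unfolding E_def F T H1_shift[OF q(2) z1] by (simp only: mult_minus_left)
    qed
  qed
  \<comment> \<open>Each application of the functional equation gains |q|^3, since |z| \<le> 1, and
    moves to the next circle. The given z lies on the circle N = 0.\<close>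
  have "norm (E z) \<le> (norm q ^ 3) ^ m * C" if "norm z = norm q ^ (2 * N)" for z N m
    using that
  proof (induction m arbitrary: z N)
    case 0
    then show ?case using step(1) by simp
  next
    case (Suc m)
    have "norm (z * q\<^sup>2) = norm q ^ (2 * Suc N)"
      using Suc.prems by (simp add: norm_mult norm_power power_add power2_eq_square)
    then have IH: "norm (E (z * q\<^sup>2)) \<le> (norm q ^ 3) ^ m * C" by (rule Suc.IH)
    have "norm (E z) = norm z ^ 3 * (norm q ^ 3 * norm (E (z * q\<^sup>2)))"
      by (subst step(2)[OF Suc.prems]) (simp add: norm_mult norm_power)
    also have "\<dots> \<le> 1 * (norm q ^ 3 * ((norm q ^ 3) ^ m * C))"
      using IH Suc.prems q by (intro mult_mono power_le_one mult_left_mono) (auto simp: power_le_one)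
    finally show ?case by (simp add: mult_ac)
  qed
  then have "norm (E z) \<le> (norm q ^ 3) ^ m * C" for m
    using z by (metis mult_0_right power_0)
  moreover have "(\<lambda>m. (norm q ^ 3) ^ m * C) \<longlonglongrightarrow> 0 * C"
    using q by (intro tendsto_mult_right LIMSEQ_power_zero) (simp add: power_less_one_iff)
  ultimately have "norm (E z) \<le> 0"
    by (intro LIMSEQ_le_const[of "\<lambda>m. (norm q ^ 3) ^ m * C"]) auto
  then show ?thesis by (simp add: E_def algebra_simps)
qed

section \<open>The theta functions for real arguments\<close>

lemma e2pi_add: "e2pi (x + y) = e2pi x * e2pi y"
  by (simp add: e2pi_def exp_add ring_distribs)

lemma e2pi_nonzero [simp]: "e2pi x \<noteq> 0"
  by (simp add: e2pi_def)

lemma e2pi_minus: "e2pi (- x) = inverse (e2pi x)"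
  by (simp add: e2pi_def exp_minus)

lemma e2pi_of_nat_mult: "e2pi (of_nat n * x) = e2pi x ^ n"
  by (simp add: e2pi_def mult_ac flip: exp_of_nat_mult)

lemma norm_e2pi: "norm (e2pi x) = exp (- 2 * pi * Im x)"
  by (simp add: e2pi_def)

text \<open>For real u the last factor has norm 1. The Gaussian decay is symmetric under k
  \<rightarrow> -k - 1, so one geometric majorant over the naturals serves both halves.\<close>

lemma theta_terms_summable:
  assumes "Im \<tau> > 0" and u: "Im u = 0"
  shows "(\<lambda>k. norm ((-1) powi k * e2pi (of_real ((of_int k + 1/2)\<^sup>2 / 2) * \<tau>) *
     e2pi (of_real (of_int k + 1/2) * u))) summable_on (UNIV :: int set)" (is "(\<lambda>k. norm (?f k)) summable_on _")
proof -
  let ?r = "exp (- pi * Im \<tau>)"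
  have f: "norm (?f k) = exp (- pi * Im \<tau> * (of_int k + 1/2)\<^sup>2)" for k
    using u by (simp add: norm_mult norm_e2pi norm_power_int)
  have geo: "(\<lambda>n::nat. ?r ^ n) summable_on UNIV"
    using assms by (intro summable_nonneg_imp_summable_on summable_geometric) (auto simp: mult_pos_pos)
  have le: "exp (- pi * Im \<tau> * (of_nat n + 1/2)\<^sup>2) \<le> ?r ^ n" for n :: nat
  proof -
    have "real n \<le> (of_nat n + 1/2)\<^sup>2" by (simp add: power2_eq_square algebra_simps)
    then have "pi * Im \<tau> * real n \<le> pi * Im \<tau> * (of_nat n + 1/2)\<^sup>2"
      using assms by (intro mult_left_mono) auto
    then show ?thesis by (simp add: mult_ac flip: exp_of_nat_mult)
  qed
  have s: "(\<lambda>n::nat. exp (- pi * Im \<tau> * (of_nat n + 1/2)\<^sup>2)) summable_on UNIV"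
    by (rule summable_on_comparison_test[OF geo]) (use le in auto)
  have "(\<lambda>k. norm (?f k)) summable_on {0..}"
    unfolding f by (rule summable_on_reindex_bij_witness[of _ int nat, THEN iffD2, OF _ _ _ _ _ s])
       auto
  moreover have "(\<lambda>k. norm (?f k)) summable_on {..<0}"
    unfolding f by (rule summable_on_reindex_bij_witness[of _ "\<lambda>n. - int n - 1" "\<lambda>k. nat (- k - 1)", THEN iffD2, OF _ _ _ _ _ s])
       (auto simp: power2_eq_square algebra_simps)
  ultimately have "(\<lambda>k. norm (?f k)) summable_on ({0..} \<union> {..<0})"
    by (intro summable_on_Un_disjoint) auto
  moreover have "{0..} \<union> {..<0} = (UNIV :: int set)" by auto
  ultimately show ?thesis by simp
qed

lemma theta_sum_eq_partial_theta:
  fixes u :: real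
  assumes \<tau>: "Im \<tau> > 0"
  shows "jacobi_theta (2 * of_real u) (2 * \<tau>) + false_theta (2 * of_real u) (2 * \<tau>) =
    2 * \<i> * e2pi (\<tau> / 4) * partial_theta (e2pi (of_real u)) (e2pi \<tau>)"
proof -
  let ?\<zeta> = "e2pi (of_real u)" and ?q = "e2pi \<tau>"
  let ?f = "\<lambda>k::int. (-1) powi k * e2pi (of_real ((of_int k + 1/2)\<^sup>2 / 2) * (2 * \<tau>)) *
     e2pi (of_real (of_int k + 1/2) * (2 * of_real u))"
  let ?s = "\<lambda>k::int. of_real (sgn (of_int k + 1/2 :: real)) * ?f k"
  have nf: "(\<lambda>k. norm (?f k)) summable_on UNIV"
    using theta_terms_summable[of "2 * \<tau>" "2 * of_real u"] \<tau> by simp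
  have f: "?f summable_on UNIV" by (rule abs_summable_summable[OF nf])
  have s: "?s summable_on UNIV"
    by (rule abs_summable_summable, rule Infinite_Sum.abs_summable_on_comparison_test[OF nf])
       (auto simp: norm_mult sgn_if)
  have q: "norm ?q < 1" and \<zeta>: "norm ?\<zeta> \<le> 1"
    using \<tau> by (auto simp: norm_e2pi)
  have "jacobi_theta (2 * of_real u) (2 * \<tau>) + false_theta (2 * of_real u) (2 * \<tau>) =
    \<i> * (infsum ?f UNIV + infsum ?s UNIV)"
    by (simp add: jacobi_theta_def false_theta_def Let_def distrib_left mult.assoc)
  also have "infsum ?f UNIV + infsum ?s UNIV = (\<Sum>\<^sub>\<infinity>k. ?f k + ?s k)"
    by (rule infsum_add[OF f s, symmetric])
  \<comment> \<open>k + 1/2 is never 0 and Im u = 0, so the sign is 1 for k \<ge> 0 and -1 for k <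
    0: the terms double or cancel.\<close>
  also have "\<dots> = (\<Sum>\<^sub>\<infinity>k\<in>{0..}. 2 * ?f k)"
    by (rule infsum_cong_neutral) (auto simp: sgn_if)
  also have "\<dots> = (\<Sum>\<^sub>\<infinity>n. 2 * ?f (int n))"
    by (rule infsum_reindex_bij_witness[of _ int nat]) auto
  also have "\<dots> = (\<Sum>\<^sub>\<infinity>n. 2 * e2pi (\<tau> / 4) * ((-1) ^ n * ?\<zeta> ^ (2 * n + 1) * ?q ^ (n\<^sup>2 + n)))"
  proof (rule infsum_cong)
    fix n :: nat
    have "of_real ((of_int (int n) + 1/2)\<^sup>2 / 2) * (2 * \<tau>) = \<tau> / 4 + of_nat (n\<^sup>2 + n) * \<tau>"
      by (simp add: power2_eq_square field_simps)
    moreover have "of_real (of_int (int n) + 1/2) * (2 * of_real u) = of_nat (2 * n + 1) * (of_real u :: complex)"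
      by (simp add: field_simps)
    ultimately show "2 * ?f (int n) = 2 * e2pi (\<tau> / 4) * ((-1) ^ n * ?\<zeta> ^ (2 * n + 1) * ?q ^ (n\<^sup>2 + n))"
      by (simp only: e2pi_add e2pi_of_nat_mult power_int_of_nat) (simp only: mult_ac)
  qed
  also have "\<dots> = 2 * e2pi (\<tau> / 4) * partial_theta ?\<zeta> ?q"
  proof -
    have "summable (\<lambda>n. norm ((-1) ^ n * ?\<zeta> ^ (2 * n + 1) * ?q ^ (n\<^sup>2 + n)))"
      by (rule summable_comparison_test'[of "\<lambda>n. norm ?q ^ n"])
         (use partial_theta_summable(1)[OF q \<zeta>] q in \<open>auto simp: summable_geometric\<close>)
    from norm_summable_imp_has_sum[OF this summable_sums[OF partial_theta_summable(2)[OF q \<zeta>]]]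
    show ?thesis
      unfolding partial_theta_def by (intro infsumI has_sum_cmult_right)
  qed
  finally show ?thesis by (simp add: mult_ac)
qed

text \<open>The eta quotients cancel up to a power of q. The normalising power is q^(-1/3), not the
  q^(-1/4) of the statement in words: the prefactors give q^(1/12) and the theta functions q^(1/4),
  so q^(-1/4) would leave a factor q^(1/12).\<close>

lemma OU1_eq:
  fixes u :: real
  assumes \<tau>: "Im \<tau> > 0"
  shows "e2pi (- \<tau> / 3) * OU1 (of_real u) \<tau> =
    partial_theta (e2pi (of_real u)) (e2pi \<tau>) / odd_poch_inf (e2pi \<tau>) (e2pi (of_real u))"
proof -
  let ?\<zeta> = "e2pi (of_real u)" and ?q = "e2pi \<tau>"
  have q: "norm ?q < 1" and \<zeta>: "norm ?\<zeta> = 1"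
    using \<tau> by (auto simp: norm_e2pi)
  have q2: "e2pi (2 * \<tau>) = ?q\<^sup>2" using e2pi_of_nat_mult[of 2 \<tau>] by simp
  have nq2: "norm (?q\<^sup>2) < 1" using q by (simp add: norm_power power_less_one_iff)
  \<comment> \<open>Every factor is 1 - a q^k with k > 0, and |a q^k| = |q|^k < 1.\<close>
  have nz: "qpoch_inf (a * ?q) ?q \<noteq> 0" "qpoch_inf (a * ?q\<^sup>2) (?q\<^sup>2) \<noteq> 0" if "norm a = 1" for a
  proof -
    have ne: "a * ?q ^ k \<noteq> 1" if "k > 0" for k
    proof
      assume "a * ?q ^ k = 1"
      then have "norm ?q ^ k = 1" using \<open>norm a = 1\<close> by (metis mult_1 norm_mult norm_one norm_power)
      then show False using q that by (metis norm_ge_zero power_less_one_iff less_irrefl neq0_conv)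
    qed
    show "qpoch_inf (a * ?q) ?q \<noteq> 0"
      using ne[of "Suc _"] by (intro qpoch_inf_LIMSEQ(2) q) (simp add: mult.assoc)
    have "a * ?q ^ (2 + 2 * k) \<noteq> 1" for k by (rule ne) simp
    then show "qpoch_inf (a * ?q\<^sup>2) (?q\<^sup>2) \<noteq> 0"
      by (intro qpoch_inf_LIMSEQ(2) nq2) (simp only: power_add power_mult mult.assoc not_False_eq_True)
  qed
  define Q Q2 where "Q = qpoch_inf ?q ?q" and "Q2 = qpoch_inf (?q\<^sup>2) (?q\<^sup>2)"
  define A1 A2 B1 B2 where "A1 = qpoch_inf (?\<zeta> * ?q) (?q\<^sup>2)" and "A2 = qpoch_inf (?\<zeta> * ?q\<^sup>2) (?q\<^sup>2)"
    and "B1 = qpoch_inf (inverse ?\<zeta> * ?q) (?q\<^sup>2)" and "B2 = qpoch_inf (inverse ?\<zeta> * ?q\<^sup>2) (?q\<^sup>2)"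
  \<comment> \<open>The even parts A2 and B2 are the products in \<open>Cstar\<close> at 2\<tau> and
    cancel; the odd parts A1 and B1 remain in the denominator.\<close>
  have split: "qpoch_inf (?\<zeta> * ?q) ?q = A1 * A2" "qpoch_inf (inverse ?\<zeta> * ?q) ?q = B1 * B2"
    unfolding A1_def A2_def B1_def B2_def
    by (subst qpoch_inf_even_odd[OF q], simp add: power2_eq_square mult.assoc)+
  have nzs: "A1 \<noteq> 0" "A2 \<noteq> 0" "B1 \<noteq> 0" "B2 \<noteq> 0" "Q \<noteq> 0" "Q2 \<noteq> 0"
    using nz[of ?\<zeta>] nz[of "inverse ?\<zeta>"] nz[of 1] \<zeta> split
    by (auto simp: norm_inverse Q_def Q2_def A1_def A2_def B1_def B2_def)
  have P: "odd_poch_inf ?q ?\<zeta> = A1 * B1"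
    by (simp add: odd_poch_inf_def A1_def B1_def divide_inverse mult.commute)
  have "Cstar (of_real u) \<tau> / dedekind_eta \<tau> * (dedekind_eta (2 * \<tau>) / Cstar (of_real u) (2 * \<tau>)) =
    (e2pi (- \<tau> / 24) * inverse (e2pi (\<tau> / 24)) * e2pi (2 * \<tau> / 24) * inverse (e2pi (- (2 * \<tau>) / 24))) / (A1 * B1)"
    using nzs unfolding Cstar_def dedekind_eta_def crank_gf_def q2 split
      Q_def[symmetric] Q2_def[symmetric] A2_def[symmetric] B2_def[symmetric]
    by (simp add: field_simps)
  also have "e2pi (- \<tau> / 24) * inverse (e2pi (\<tau> / 24)) * e2pi (2 * \<tau> / 24) * inverse (e2pi (- (2 * \<tau>) / 24)) = e2pi (\<tau> / 12)"
    unfolding e2pi_minus[symmetric] e2pi_add[symmetric] by (simp add: field_simps)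
  finally have quot: "Cstar (of_real u) \<tau> / dedekind_eta \<tau> *
    (dedekind_eta (2 * \<tau>) / Cstar (of_real u) (2 * \<tau>)) = e2pi (\<tau> / 12) / (A1 * B1)" .
  have "e2pi (- \<tau> / 3) * OU1 (of_real u) \<tau> =
     e2pi (- \<tau> / 3) * (- (\<i> / 2)) * (2 * \<i> * e2pi (\<tau> / 4) * partial_theta ?\<zeta> ?q) *
     (Cstar (of_real u) \<tau> / dedekind_eta \<tau> *
       (dedekind_eta (2 * \<tau>) / Cstar (of_real u) (2 * \<tau>)))"
    unfolding OU1_def theta_sum_eq_partial_theta[OF \<tau>] by (simp only: mult_ac)
  also have "\<dots> = - (\<i> / 2) * (2 * \<i>) * (e2pi (- \<tau> / 3) * e2pi (\<tau> / 12) * e2pi (\<tau> / 4)) * partial_theta ?\<zeta> ?q / (A1 * B1)"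
    unfolding quot by (simp add: mult_ac)
  also have "e2pi (- \<tau> / 3) * e2pi (\<tau> / 12) * e2pi (\<tau> / 4) = 1"
    unfolding e2pi_add[symmetric] by (simp add: e2pi_def)
  finally show ?thesis by (simp add: P)
qed

theorem lemma3p1:
  fixes \<tau> :: complex and l :: nat
  assumes "Im \<tau> > 0" and "even l"
  shows "real_deriv_iter l (\<lambda>u. OU (e2pi (of_real u)) (e2pi \<tau>)) 0 =
         real_deriv_iter l (\<lambda>u. e2pi (- \<tau> / 3) * OU1 (of_real u) \<tau>
                                + H1 (e2pi (of_real u)) (e2pi \<tau>)) 0"
proof -
  have q: "norm (e2pi \<tau>) < 1" using assms by (simp add: norm_e2pi)
  have "OU (e2pi (of_real u)) (e2pi \<tau>) = e2pi (- \<tau> / 3) * OU1 (of_real u) \<tau>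
    + H1 (e2pi (of_real u)) (e2pi \<tau>)" for u :: real
  proof -
    have "norm (e2pi (of_real u)) = 1" by (simp add: norm_e2pi)
    then show ?thesis
      using OU_eq_suminf[OF q e2pi_nonzero] odd_poch_suminf_eq[OF e2pi_nonzero q]
      unfolding OU1_eq[OF assms(1)] by simp
  qed
  then show ?thesis by simp
qed

end
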